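(* Consider the grid-aligned anisotropic diffusion equation $-u_{xx}-\epsilon u_{yy}=f$ with anisotropy ratio $\epsilon\in[0,1]$, discretized with either the finite-difference (FD) stencil or the bilinear finite-element (FE) stencil. Let $\mu_{2,2}(\epsilon)$ be the smoothing factor of maximally overlapping multiplicative Schwarz with $2\times 2$ subdomains. Then $$\mu_{2,2}(\epsilon)\ \ge\ 1-c\,\epsilon+\mathcal{O}(\epsilon^2),$$ with $c=12$ for the FD discretization and $c=19.2$ for the FE discretization. As such, this smoother is not $\epsilon$-robust for either discretization, since $\lim_{\epsilon\to0^+}\mu_{2,2}(\epsilon)\ge 1$.
   Context: **Stencils.** A 9-point stencil has entries $s_{nw},s_n,s_{ne},s_w,s_c,s_e,s_{sw},s_s,s_{se}$ (compass directions; $s_c$ is the center). For both discretizations below $s_{ne}=s_{sw}=s_{se}=s_{nw}$, $s_s=s_n$, $s_e=s_w$. Up to an overall positive scaling (which does not affect the symbol below): FD: $s_{nw}=0$, $s_n=-\epsilon$, $s_w=-1$, $s_c=2(1+\epsilon)$. FE: $s_{nw}=-\tfrac16-\tfrac16\epsilon$, $s_n=\tfrac13-\tfrac23\epsilon$, $s_w=-\tfrac23+\tfrac13\epsilon$, $s_c=\tfrac43+\tfrac43\epsilon$. For a frequency $(\omega_1,\omega_2)$ put $\check s_{d}=s_d\,e^{\mathrm{i}(p\,\omega_1+q\,\omega_2)}$, where $(p,q)\in\{-1,0,1\}^2$ is the grid offset of direction $d$ (east: $p=1$; west: $p=-1$; north: $q=1$; south: $q=-1$); e.g. $\check s_{nw}=s_{nw}e^{\mathrm{i}(-\omega_1+\omega_2)}$,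 $\check s_c=s_c$. **Smoother and its Fourier symbol.** Multiplicative Schwarz sweeps sequentially over all $2\times2$ blocks of neighboring unknowns (one block anchored at every grid point $(i,j)$, consisting of the points $(i,j),(i+1,j),(i,j+1),(i+1,j+1)$ in this order), west to east and then south to north; for each block it updates the four unknowns so that their residuals become zero. Each unknown is thus updated 4 times per sweep. In local Fourier analysis (infinite grid), the error is a Fourier mode $e^{\mathrm{i}(\omega_1 i+\omega_2 j)}$ times an amplitude $\alpha_p$ depending on the number of times $p$ the point has been updated, and the symbol is $\tilde s(\omega_1,\omega_2)=\alpha_4/\alpha_0=(\mathcal A^{-1}\mathbf b)_1$ (first component), where $$\mathcal A=A_{ij}D(U-I)-DC,\qquad \mathbf b=D\mathbf c-A_{ij}D\mathbf e_4,$$ $D=\mathrm{diag}(1,e^{\mathrm i\omega_1},e^{\mathrm i\omega_2},e^{\mathrm i(\omega_1+\omega_2)})$, $\mathbf e_4=(0,0,0,1)^\top$, $U-I$ is the $4\times4$ matrix with $-1$ on the diagonal and $1$ on the first superdiagonal, $$A_{ij}=\begin{bmatrix}s_c&s_e&s_n&s_{ne}\\ s_w&s_c&s_{nw}&s_n\\ s_s&s_{se}&s_c&s_e\\ s_{sw}&s_s&s_w&s_c\end{bmatrix},$$ $$C=\begin{bmatrix}\check s_{sw}+\check s_s+\check s_{se}+\check s_w&\check s_c&\check s_e+\check s_{nw}&\check s_n\\ \check s_{sw}+\check s_s+\check s_{se}&\check s_w&\check s_c+\check s_e&\check s_{nw}\\ \check s_{sw}&\check s_s&\check s_{se}+\check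 s_w&\check s_c\\ 0&\check s_{sw}&\check s_s+\check s_{se}&\check s_w\end{bmatrix},\qquad \mathbf c=\begin{bmatrix}\check s_{ne}\\ \check s_n+\check s_{ne}\\ \check s_e+\check s_{nw}+\check s_n+\check s_{ne}\\ \check s_c+\check s_e+\check s_{nw}+\check s_n+\check s_{ne}\end{bmatrix}.$$ **Smoothing factor.** $\mu=\max|\tilde s(\omega_1,\omega_2)|$ over the high frequencies $(\omega_1,\omega_2)\in[-\pi/2,3\pi/2)^2\setminus[-\pi/2,\pi/2)^2$. **$\epsilon$-robustness.** A class of smoothers is $\epsilon$-robust if its smoothing factor satisfies $\mu(\epsilon)\le\eta<1$ for all $\epsilon\in[0,1]$ and some constant $\eta$. $\mathcal O(\cdot)$ is understood as $\epsilon\to0^+$. *)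

theory Defs
  imports "HOL-Analysis.Analysis" "HOL-Library.Landau_Symbols"
begin

datatype compass = NW | N | NE | W | Ctr | E | SW | S | SE

fun offset :: "compass \<Rightarrow> int \<times> int" where
  "offset NW = (-1, 1)"
| "offset N = (0, 1)"
| "offset NE = (1, 1)"
| "offset W = (-1, 0)"
| "offset Ctr = (0, 0)"
| "offset E = (1, 0)"
| "offset SW = (-1, -1)"
| "offset S = (0, -1)"
| "offset SE = (1, -1)"

type_synonym stencil = "compass \<Rightarrow> real"

fun symmetric_stencil :: "real \<Rightarrow> real \<Rightarrow> real \<Rightarrow> real \<Rightarrow> stencil" where
  "symmetric_stencil nw n w c NW = nw"
| "symmetric_stencil nw n w c N = n"
| "symmetric_stencil nw n w c NE = nw"
| "symmetric_stencil nw n w c W = w"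
| "symmetric_stencil nw n w c Ctr = c"
| "symmetric_stencil nw n w c E = w"
| "symmetric_stencil nw n w c SW = nw"
| "symmetric_stencil nw n w c S = n"
| "symmetric_stencil nw n w c SE = nw"

text \<open>
  The discretizations of \<open>- u\<^sub>x\<^sub>x - \<epsilon> u\<^sub>y\<^sub>y = f\<close> by finite differences and by
  bilinear finite elements, up to a positive scaling, which cancels in the
  Fourier symbol below.
\<close>

definition fd_stencil :: "real \<Rightarrow> stencil" where
  "fd_stencil \<epsilon> = symmetric_stencil 0 (- \<epsilon>) (- 1) (2 * (1 + \<epsilon>))"

definition fe_stencil :: "real \<Rightarrow> stencil" where
  "fe_stencil \<epsilon> = symmetric_stencil
     (- 1/6 - 1/6 * \<epsilon>) (1/3 - 2/3 * \<epsilon>) (- 2/3 + 1/3 * \<epsilon>) (4/3 + 4/3 * \<epsilon>)"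

definition modulated :: "stencil \<Rightarrow> real \<Rightarrow> real \<Rightarrow> compass \<Rightarrow> complex" where
  "modulated s \<omega>\<^sub>1 \<omega>\<^sub>2 d =
     of_real (s d) * cis (of_int (fst (offset d)) * \<omega>\<^sub>1 + of_int (snd (offset d)) * \<omega>\<^sub>2)"

text \<open>
  Local Fourier analysis of the multiplicative Schwarz sweep with maximally
  overlapping \<open>2 \<times> 2\<close> blocks.  The unknowns of a block are ordered as
  \<open>(i, j), (i + 1, j), (i, j + 1), (i + 1, j + 1)\<close>.  On the Fourier mode of frequency
  \<open>(\<omega>\<^sub>1, \<omega>\<^sub>2)\<close> the error at a point that has been updated \<open>p\<close> times has amplitude
  \<open>\<alpha>\<^sub>p\<close>, and annihilating the four block residuals gives the linear system
  \<open>lfa_matrix *v (\<alpha>\<^sub>4, \<alpha>\<^sub>3, \<alpha>\<^sub>2, \<alpha>\<^sub>1) = \<alpha>\<^sub>0 lfa_rhs\<close>.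
\<close>

definition block_matrix :: "stencil \<Rightarrow> complex^4^4" where
  "block_matrix s = (\<chi> i j. of_real ((vector
     [vector [s Ctr, s E, s N, s NE],
      vector [s W, s Ctr, s NW, s N],
      vector [s S, s SE, s Ctr, s E],
      vector [s SW, s S, s W, s Ctr]] :: real^4^4) $ i $ j))"

definition phase_matrix :: "real \<Rightarrow> real \<Rightarrow> complex^4^4" where
  "phase_matrix \<omega>\<^sub>1 \<omega>\<^sub>2 = (\<chi> i j.
     if i = j then (vector [1, cis \<omega>\<^sub>1, cis \<omega>\<^sub>2, cis (\<omega>\<^sub>1 + \<omega>\<^sub>2)] :: complex^4) $ i else 0)"

definition shift_minus_id :: "complex^4^4" where
  "shift_minus_id = vector
     [vector [-1, 1, 0, 0],
      vector [0, -1, 1, 0],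
      vector [0, 0, -1, 1],
      vector [0, 0, 0, -1]]"

definition coupling_matrix :: "stencil \<Rightarrow> real \<Rightarrow> real \<Rightarrow> complex^4^4" where
  "coupling_matrix s \<omega>\<^sub>1 \<omega>\<^sub>2 = (let t = modulated s \<omega>\<^sub>1 \<omega>\<^sub>2 in vector
     [vector [t SW + t S + t SE + t W, t Ctr, t E + t NW, t N],
      vector [t SW + t S + t SE, t W, t Ctr + t E, t NW],
      vector [t SW, t S, t SE + t W, t Ctr],
      vector [0, t SW, t S + t SE, t W]])"

definition coupling_vector :: "stencil \<Rightarrow> real \<Rightarrow> real \<Rightarrow> complex^4" where
  "coupling_vector s \<omega>\<^sub>1 \<omega>\<^sub>2 = (let t = modulated s \<omega>\<^sub>1 \<omega>\<^sub>2 in vector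
     [t NE,
      t N + t NE,
      t E + t NW + t N + t NE,
      t Ctr + t E + t NW + t N + t NE])"

definition lfa_matrix :: "stencil \<Rightarrow> real \<Rightarrow> real \<Rightarrow> complex^4^4" where
  "lfa_matrix s \<omega>\<^sub>1 \<omega>\<^sub>2 =
     block_matrix s ** phase_matrix \<omega>\<^sub>1 \<omega>\<^sub>2 ** shift_minus_id
     - phase_matrix \<omega>\<^sub>1 \<omega>\<^sub>2 ** coupling_matrix s \<omega>\<^sub>1 \<omega>\<^sub>2"

definition lfa_rhs :: "stencil \<Rightarrow> real \<Rightarrow> real \<Rightarrow> complex^4" where
  "lfa_rhs s \<omega>\<^sub>1 \<omega>\<^sub>2 =
     phase_matrix \<omega>\<^sub>1 \<omega>\<^sub>2 *v coupling_vector s \<omega>\<^sub>1 \<omega>\<^sub>2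
     - block_matrix s *v (phase_matrix \<omega>\<^sub>1 \<omega>\<^sub>2 *v axis 4 1)"

definition schwarz_symbol :: "stencil \<Rightarrow> real \<Rightarrow> real \<Rightarrow> complex" where
  "schwarz_symbol s \<omega>\<^sub>1 \<omega>\<^sub>2 = (matrix_inv (lfa_matrix s \<omega>\<^sub>1 \<omega>\<^sub>2) *v lfa_rhs s \<omega>\<^sub>1 \<omega>\<^sub>2) $ 1"

definition high_frequencies :: "(real \<times> real) set" where
  "high_frequencies =
     ({- pi/2 ..< 3 * pi/2} \<times> {- pi/2 ..< 3 * pi/2}) - ({- pi/2 ..< pi/2} \<times> {- pi/2 ..< pi/2})"

text \<open>
  The set of high frequencies is not closed, so the maximum defining the smoothing
  factor is written as a supremum.  The two agree wherever the symbol is continuous: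
  it is \<open>2\<pi>\<close>-periodic, and the missing boundary points modulo \<open>2\<pi>\<close> are negatives of
  high frequencies, at which the symbol is the complex conjugate.
\<close>

definition smoothing_factor :: "stencil \<Rightarrow> real" where
  "smoothing_factor s =
     (SUP (\<omega>\<^sub>1, \<omega>\<^sub>2) \<in> high_frequencies. cmod (schwarz_symbol s \<omega>\<^sub>1 \<omega>\<^sub>2))"

text \<open>The argument gives the smoothing factor as a function of the anisotropy ratio.\<close>

definition epsilon_robust :: "(real \<Rightarrow> real) \<Rightarrow> bool" where
  "epsilon_robust \<mu> \<longleftrightarrow> (\<exists>\<eta><1. \<forall>\<epsilon>\<in>{0..1}. \<mu> \<epsilon> \<le> \<eta>)"

end

theory Submission
  imports Defs "HOL-Real_Asymp.Real_Asymp"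
begin

text \<open>
  Read the symbol as one error mode that is swept block by block.  A block solve is a projection
  that is orthogonal in the energy inner product of the operator: if \<open>d\<close> is the correction,
  supported on the block, and \<open>B\<close> the block matrix, it lowers the energy of the error by exactly
  \<open>d\<^sup>* B d\<close>.  On the other hand the error after the solve is, up to a phase, the error before
  it moved one point to the east, so the sweep has turned one more grid point from amplitude
  \<open>\<alpha>\<^sub>0\<close> into amplitude \<open>\<alpha>\<^sub>4\<close>.  Since a mode of amplitude \<open>\<alpha>\<close> has energy density
  \<open>a(\<omega>) \<bar>\<alpha>\<bar>\<^sup>2\<close>, with \<open>a\<close> the Fourier symbol of the operator, counting the energy per
  step in both ways gives

  \<open>a(\<omega>) (\<bar>\<alpha>\<^sub>0\<bar>\<^sup>2 - \<bar>\<alpha>\<^sub>4\<bar>\<^sup>2) = d\<^sup>* B d\<close>.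

  The energies of the infinite grid diverge, but the balance is a polynomial identity in the
  amplitudes and the phases, proved in \<open>block_solve_energy_change\<close> and \<open>energy_balance\<close>.

  For \<open>\<epsilon> > 0\<close> the block matrix is positive definite and \<open>a\<close> is positive at the high
  frequencies, for both stencils.  Then the balance with \<open>\<alpha>\<^sub>0 = 0\<close> forces \<open>d = 0\<close>, so the
  linear system for the amplitudes is nonsingular; and with \<open>\<alpha>\<^sub>0 = 1\<close> it shows that the symbol
  has modulus at most 1.  Thus the supremum defining the smoothing factor is a genuine one, it is
  bounded by 1, and it dominates the symbol at every single high frequency.

  The lower bound comes from the frequency \<open>(0, \<pi>/2)\<close>, an error that is constant in the
  strongly coupled direction and of the lowest high frequency in the other.  There the system is
  solved in closed form, and the modulus of the symbol is \<open>1 - c \<epsilon> + O(\<epsilon>\<^sup>2)\<close> with the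
  two values of \<open>c\<close> in question.  Between this and 1 the smoothing factor is squeezed to the
  limit 1, which excludes robustness.
\<close>

section \<open>Vectors of length four and matrix inverses\<close>

lemma vector_4 [simp]:
  "(vector [a, b, c, d] :: 'a::zero^4) $ 1 = a"
  "(vector [a, b, c, d] :: 'a::zero^4) $ 2 = b"
  "(vector [a, b, c, d] :: 'a::zero^4) $ 3 = c"
  "(vector [a, b, c, d] :: 'a::zero^4) $ 4 = d"
  unfolding vector_def by simp_all

lemma matrix_inv_mult_vector:
  fixes A :: "'a::field^'n^'n"
  assumes "invertible A" and "A *v x = b"
  shows "matrix_inv A *v b = x"
proof -
  have "matrix_inv A ** A = mat 1"
    unfolding matrix_inv_def using someI_ex [of "\<lambda>B. A ** B = mat 1 \<and> B ** A = mat 1"] assms(1)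
    by (auto simp: invertible_def)
  then show ?thesis
    by (simp add: assms(2) [symmetric] matrix_vector_mul_assoc)
qed

section \<open>The amplitude system as a block solve\<close>

text \<open>The error before the block solve minus the error after it, at the four points of the block.\<close>

definition correction :: "real \<Rightarrow> real \<Rightarrow> complex \<Rightarrow> complex^4 \<Rightarrow> complex^4" where
  "correction \<omega>\<^sub>1 \<omega>\<^sub>2 \<alpha>\<^sub>0 \<alpha> = phase_matrix \<omega>\<^sub>1 \<omega>\<^sub>2 *v (shift_minus_id *v \<alpha> + \<alpha>\<^sub>0 *s axis 4 1)"

text \<open>The residual, at the four points of the block, of the error before the block solve.\<close>

definition residual :: "stencil \<Rightarrow> real \<Rightarrow> real \<Rightarrow> complex \<Rightarrow> complex^4 \<Rightarrow> complex^4" where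
  "residual s \<omega>\<^sub>1 \<omega>\<^sub>2 \<alpha>\<^sub>0 \<alpha> =
     phase_matrix \<omega>\<^sub>1 \<omega>\<^sub>2 *v (coupling_matrix s \<omega>\<^sub>1 \<omega>\<^sub>2 *v \<alpha> + \<alpha>\<^sub>0 *s coupling_vector s \<omega>\<^sub>1 \<omega>\<^sub>2)"

lemma lfa_system_iff_block_solve:
  "lfa_matrix s \<omega>\<^sub>1 \<omega>\<^sub>2 *v \<alpha> = \<alpha>\<^sub>0 *s lfa_rhs s \<omega>\<^sub>1 \<omega>\<^sub>2 \<longleftrightarrow>
   block_matrix s *v correction \<omega>\<^sub>1 \<omega>\<^sub>2 \<alpha>\<^sub>0 \<alpha> = residual s \<omega>\<^sub>1 \<omega>\<^sub>2 \<alpha>\<^sub>0 \<alpha>"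
  by (simp add: lfa_matrix_def lfa_rhs_def correction_def residual_def
      matrix_vector_mult_diff_rdistrib matrix_vector_mul_assoc [symmetric]
      matrix_vector_right_distrib vector_ssub_ldistrib vec.scale algebra_simps)

lemma correction_nth:
  "correction \<omega>\<^sub>1 \<omega>\<^sub>2 \<alpha>\<^sub>0 \<alpha> $ 1 = \<alpha>$2 - \<alpha>$1"
  "correction \<omega>\<^sub>1 \<omega>\<^sub>2 \<alpha>\<^sub>0 \<alpha> $ 2 = cis \<omega>\<^sub>1 * (\<alpha>$3 - \<alpha>$2)"
  "correction \<omega>\<^sub>1 \<omega>\<^sub>2 \<alpha>\<^sub>0 \<alpha> $ 3 = cis \<omega>\<^sub>2 * (\<alpha>$4 - \<alpha>$3)"
  "correction \<omega>\<^sub>1 \<omega>\<^sub>2 \<alpha>\<^sub>0 \<alpha> $ 4 = cis (\<omega>\<^sub>1 + \<omega>\<^sub>2) * (\<alpha>\<^sub>0 - \<alpha>$4)"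
  by (simp_all add: correction_def phase_matrix_def shift_minus_id_def matrix_vector_mult_def
      sum_4 axis_def algebra_simps)

lemma residual_nth:
  fixes s \<omega>\<^sub>1 \<omega>\<^sub>2
  defines "t \<equiv> modulated s \<omega>\<^sub>1 \<omega>\<^sub>2"
  shows
  "residual s \<omega>\<^sub>1 \<omega>\<^sub>2 \<alpha>\<^sub>0 \<alpha> $ 1 =
     (t SW + t S + t SE + t W) * \<alpha>$1 + t Ctr * \<alpha>$2 + (t E + t NW) * \<alpha>$3 + t N * \<alpha>$4 + t NE * \<alpha>\<^sub>0"
  "residual s \<omega>\<^sub>1 \<omega>\<^sub>2 \<alpha>\<^sub>0 \<alpha> $ 2 = cis \<omega>\<^sub>1 *
     ((t SW + t S + t SE) * \<alpha>$1 + t W * \<alpha>$2 + (t Ctr + t E) * \<alpha>$3 + t NW * \<alpha>$4 + (t N + t NE) * \<alpha>\<^sub>0)"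
  "residual s \<omega>\<^sub>1 \<omega>\<^sub>2 \<alpha>\<^sub>0 \<alpha> $ 3 = cis \<omega>\<^sub>2 *
     (t SW * \<alpha>$1 + t S * \<alpha>$2 + (t SE + t W) * \<alpha>$3 + t Ctr * \<alpha>$4 + (t E + t NW + t N + t NE) * \<alpha>\<^sub>0)"
  "residual s \<omega>\<^sub>1 \<omega>\<^sub>2 \<alpha>\<^sub>0 \<alpha> $ 4 = cis (\<omega>\<^sub>1 + \<omega>\<^sub>2) *
     (t SW * \<alpha>$2 + (t S + t SE) * \<alpha>$3 + t W * \<alpha>$4 + (t Ctr + t E + t NW + t N + t NE) * \<alpha>\<^sub>0)"
  by (simp_all add: t_def residual_def phase_matrix_def coupling_matrix_def coupling_vector_def
      matrix_vector_mult_def sum_4 Let_def)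

lemma block_matrix_nth:
  "(block_matrix s *v d) $ 1 = s Ctr * d$1 + s E * d$2 + s N * d$3 + s NE * d$4"
  "(block_matrix s *v d) $ 2 = s W * d$1 + s Ctr * d$2 + s NW * d$3 + s N * d$4"
  "(block_matrix s *v d) $ 3 = s S * d$1 + s SE * d$2 + s Ctr * d$3 + s E * d$4"
  "(block_matrix s *v d) $ 4 = s SW * d$1 + s S * d$2 + s W * d$3 + s Ctr * d$4"
  by (simp_all add: block_matrix_def matrix_vector_mult_def sum_4)

lemma modulated_simps:
  "modulated s \<omega>\<^sub>1 \<omega>\<^sub>2 NW = s NW * (cnj (cis \<omega>\<^sub>1) * cis \<omega>\<^sub>2)"
  "modulated s \<omega>\<^sub>1 \<omega>\<^sub>2 N = s N * cis \<omega>\<^sub>2"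
  "modulated s \<omega>\<^sub>1 \<omega>\<^sub>2 NE = s NE * (cis \<omega>\<^sub>1 * cis \<omega>\<^sub>2)"
  "modulated s \<omega>\<^sub>1 \<omega>\<^sub>2 W = s W * cnj (cis \<omega>\<^sub>1)"
  "modulated s \<omega>\<^sub>1 \<omega>\<^sub>2 Ctr = s Ctr"
  "modulated s \<omega>\<^sub>1 \<omega>\<^sub>2 E = s E * cis \<omega>\<^sub>1"
  "modulated s \<omega>\<^sub>1 \<omega>\<^sub>2 SW = s SW * (cnj (cis \<omega>\<^sub>1) * cnj (cis \<omega>\<^sub>2))"
  "modulated s \<omega>\<^sub>1 \<omega>\<^sub>2 S = s S * cnj (cis \<omega>\<^sub>2)"
  "modulated s \<omega>\<^sub>1 \<omega>\<^sub>2 SE = s SE * (cis \<omega>\<^sub>1 * cnj (cis \<omega>\<^sub>2))"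
  by (simp_all add: modulated_def cis_cnj cis_mult)

section \<open>Energy balance of a block solve\<close>

definition block_energy :: "stencil \<Rightarrow> complex^4 \<Rightarrow> real" where
  "block_energy s d = Re (\<Sum>j\<in>UNIV. cnj (d $ j) * (block_matrix s *v d) $ j)"

text \<open>
  The Fourier symbol of the discrete operator, in the real form that it takes for a centrally
  symmetric stencil.
\<close>

definition operator_symbol :: "stencil \<Rightarrow> real \<Rightarrow> real \<Rightarrow> real" where
  "operator_symbol s \<omega>\<^sub>1 \<omega>\<^sub>2 = s Ctr + 2 * s E * cos \<omega>\<^sub>1 + 2 * s N * cos \<omega>\<^sub>2
     + 2 * s NE * cos (\<omega>\<^sub>1 + \<omega>\<^sub>2) + 2 * s NW * cos (\<omega>\<^sub>2 - \<omega>\<^sub>1)"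

text \<open>Equivalent to the discrete operator on the infinite grid being symmetric.\<close>

definition centrally_symmetric :: "stencil \<Rightarrow> bool" where
  "centrally_symmetric s \<longleftrightarrow> s W = s E \<and> s S = s N \<and> s SW = s NE \<and> s SE = s NW"

text \<open>
  The energy change in polynomial form, with the phases absorbed into the modulated stencil
  \<open>t\<close>.  If \<open>d\<close> is subtracted from an error \<open>e\<close> with residual \<open>r = A e\<close>, the energy drops by
  \<open>Re d\<^sup>* (2 r - A d)\<close>.  The coefficients of \<open>tC\<close> show the mechanism: they are
  \<open>\<bar>a3\<bar>\<^sup>2 - \<bar>a4\<bar>\<^sup>2\<close>, \<open>\<bar>a2\<bar>\<^sup>2 - \<bar>a3\<bar>\<^sup>2\<close>, \<open>\<bar>a1\<bar>\<^sup>2 - \<bar>a2\<bar>\<^sup>2\<close>, \<open>\<bar>a0\<bar>\<^sup>2 - \<bar>a1\<bar>\<^sup>2\<close>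
  in the four rows and telescope.  For the other directions the cancellation takes the sum of the
  rows, because a pair of neighbouring points is seen from both of its ends.
\<close>

lemma energy_flux_identity:
  fixes tE tN tNE tNW tW tS tSW tSE a0 a1 a2 a3 a4 d1 d2 d3 d4 :: complex and tC :: real
  assumes "d1 = a3 - a4" and "d2 = a2 - a3" and "d3 = a1 - a2" and "d4 = a0 - a1"
  assumes "tW = cnj tE" and "tS = cnj tN" and "tSW = cnj tNE" and "tSE = cnj tNW"
  shows "Re (cnj d1 * (2 * ((tSW + tS + tSE + tW) * a4 + tC * a3 + (tE + tNW) * a2 + tN * a1 + tNE * a0)
             - (tC * d1 + tE * d2 + tN * d3 + tNE * d4))
      + cnj d2 * (2 * ((tSW + tS + tSE) * a4 + tW * a3 + (tC + tE) * a2 + tNW * a1 + (tN + tNE) * a0)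
             - (tW * d1 + tC * d2 + tNW * d3 + tN * d4))
      + cnj d3 * (2 * (tSW * a4 + tS * a3 + (tSE + tW) * a2 + tC * a1 + (tE + tNW + tN + tNE) * a0)
             - (tS * d1 + tSE * d2 + tC * d3 + tE * d4))
      + cnj d4 * (2 * (tSW * a3 + (tS + tSE) * a2 + tW * a1 + (tC + tE + tNW + tN + tNE) * a0)
             - (tSW * d1 + tS * d2 + tW * d3 + tC * d4)))
    = (tC + 2 * Re tE + 2 * Re tN + 2 * Re tNE + 2 * Re tNW) * ((cmod a0)\<^sup>2 - (cmod a4)\<^sup>2)"
  unfolding assms cmod_power2 by (simp add: power2_eq_square) algebra

text \<open>
  The phase of entry \<open>(j, k)\<close> relative to row \<open>j\<close> is that of the offset between the two block
  points, which turns the block matrix into the modulated stencil.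
\<close>

lemma block_matrix_correction_nth:
  fixes s \<omega>\<^sub>1 \<omega>\<^sub>2
  defines "t \<equiv> modulated s \<omega>\<^sub>1 \<omega>\<^sub>2"
  shows
  "(block_matrix s *v correction \<omega>\<^sub>1 \<omega>\<^sub>2 \<alpha>\<^sub>0 \<alpha>) $ 1 =
     t Ctr * (\<alpha>$2 - \<alpha>$1) + t E * (\<alpha>$3 - \<alpha>$2) + t N * (\<alpha>$4 - \<alpha>$3) + t NE * (\<alpha>\<^sub>0 - \<alpha>$4)"
  "(block_matrix s *v correction \<omega>\<^sub>1 \<omega>\<^sub>2 \<alpha>\<^sub>0 \<alpha>) $ 2 = cis \<omega>\<^sub>1 *
     (t W * (\<alpha>$2 - \<alpha>$1) + t Ctr * (\<alpha>$3 - \<alpha>$2) + t NW * (\<alpha>$4 - \<alpha>$3) + t N * (\<alpha>\<^sub>0 - \<alpha>$4))"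
  "(block_matrix s *v correction \<omega>\<^sub>1 \<omega>\<^sub>2 \<alpha>\<^sub>0 \<alpha>) $ 3 = cis \<omega>\<^sub>2 *
     (t S * (\<alpha>$2 - \<alpha>$1) + t SE * (\<alpha>$3 - \<alpha>$2) + t Ctr * (\<alpha>$4 - \<alpha>$3) + t E * (\<alpha>\<^sub>0 - \<alpha>$4))"
  "(block_matrix s *v correction \<omega>\<^sub>1 \<omega>\<^sub>2 \<alpha>\<^sub>0 \<alpha>) $ 4 = cis (\<omega>\<^sub>1 + \<omega>\<^sub>2) *
     (t SW * (\<alpha>$2 - \<alpha>$1) + t S * (\<alpha>$3 - \<alpha>$2) + t W * (\<alpha>$4 - \<alpha>$3) + t Ctr * (\<alpha>\<^sub>0 - \<alpha>$4))"
proof -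
  have unit: "cis \<omega>\<^sub>1 * cnj (cis \<omega>\<^sub>1) = 1" "cis \<omega>\<^sub>2 * cnj (cis \<omega>\<^sub>2) = 1"
    by (simp_all add: cis_cnj cis_mult)
  note expand = t_def correction_nth block_matrix_nth modulated_simps cis_mult [symmetric]
  show "(block_matrix s *v correction \<omega>\<^sub>1 \<omega>\<^sub>2 \<alpha>\<^sub>0 \<alpha>) $ 1 =
     t Ctr * (\<alpha>$2 - \<alpha>$1) + t E * (\<alpha>$3 - \<alpha>$2) + t N * (\<alpha>$4 - \<alpha>$3) + t NE * (\<alpha>\<^sub>0 - \<alpha>$4)"
    unfolding expand by (simp add: mult.assoc)
  show "(block_matrix s *v correction \<omega>\<^sub>1 \<omega>\<^sub>2 \<alpha>\<^sub>0 \<alpha>) $ 2 = cis \<omega>\<^sub>1 *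
     (t W * (\<alpha>$2 - \<alpha>$1) + t Ctr * (\<alpha>$3 - \<alpha>$2) + t NW * (\<alpha>$4 - \<alpha>$3) + t N * (\<alpha>\<^sub>0 - \<alpha>$4))"
    unfolding expand using unit by algebra
  show "(block_matrix s *v correction \<omega>\<^sub>1 \<omega>\<^sub>2 \<alpha>\<^sub>0 \<alpha>) $ 3 = cis \<omega>\<^sub>2 *
     (t S * (\<alpha>$2 - \<alpha>$1) + t SE * (\<alpha>$3 - \<alpha>$2) + t Ctr * (\<alpha>$4 - \<alpha>$3) + t E * (\<alpha>\<^sub>0 - \<alpha>$4))"
    unfolding expand using unit by algebra
  show "(block_matrix s *v correction \<omega>\<^sub>1 \<omega>\<^sub>2 \<alpha>\<^sub>0 \<alpha>) $ 4 = cis (\<omega>\<^sub>1 + \<omega>\<^sub>2) *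
     (t SW * (\<alpha>$2 - \<alpha>$1) + t S * (\<alpha>$3 - \<alpha>$2) + t W * (\<alpha>$4 - \<alpha>$3) + t Ctr * (\<alpha>\<^sub>0 - \<alpha>$4))"
    unfolding expand using unit by algebra
qed

text \<open>
  This holds for arbitrary amplitudes, whether or not they solve the block system: it only
  compares the state of the grid before a step with the state one step later.
\<close>

lemma block_solve_energy_change:
  fixes \<alpha> :: "complex^4" and \<alpha>\<^sub>0 :: complex and \<omega>\<^sub>1 \<omega>\<^sub>2 :: real
  assumes "centrally_symmetric s"
  defines "d \<equiv> correction \<omega>\<^sub>1 \<omega>\<^sub>2 \<alpha>\<^sub>0 \<alpha>" and "r \<equiv> residual s \<omega>\<^sub>1 \<omega>\<^sub>2 \<alpha>\<^sub>0 \<alpha>"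
  shows "Re (\<Sum>j\<in>UNIV. cnj (d $ j) * (2 * r $ j - (block_matrix s *v d) $ j))
    = operator_symbol s \<omega>\<^sub>1 \<omega>\<^sub>2 * ((cmod \<alpha>\<^sub>0)\<^sup>2 - (cmod (\<alpha> $ 1))\<^sup>2)"
proof -
  define t where "t = modulated s \<omega>\<^sub>1 \<omega>\<^sub>2"
  have t_Ctr: "t Ctr = of_real (s Ctr)"
    by (simp add: t_def modulated_simps)
  have t_cnj: "t W = cnj (t E)" "t S = cnj (t N)" "t SW = cnj (t NE)" "t SE = cnj (t NW)"
    using assms(1) by (simp_all add: t_def modulated_simps centrally_symmetric_def)
  have cancel_phase: "cnj (cis \<theta> * x) * (2 * (cis \<theta> * y) - cis \<theta> * z) = cnj x * (2 * y - z)"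
    for \<theta> x y z
  proof -
    have "cis \<theta> * cnj (cis \<theta>) = 1"
      by (simp add: cis_cnj cis_mult)
    then show ?thesis
      unfolding complex_cnj_mult by algebra
  qed
  have "operator_symbol s \<omega>\<^sub>1 \<omega>\<^sub>2 = s Ctr + 2 * Re (t E) + 2 * Re (t N) + 2 * Re (t NE) + 2 * Re (t NW)"
    by (simp add: operator_symbol_def t_def modulated_def)
  then show ?thesis
    unfolding sum_4 d_def r_def block_matrix_correction_nth
    unfolding correction_nth residual_nth cancel_phase t_def [symmetric] t_Ctr
    using energy_flux_identity [OF refl refl refl refl t_cnj] by simp
qed

text \<open>
  For a solution of the block system the residual equals the block matrix applied to the
  correction, so the energy lost is the energy of the correction itself.
\<close>

lemma energy_balance:
  assumes "centrally_symmetric s"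
    and "lfa_matrix s \<omega>\<^sub>1 \<omega>\<^sub>2 *v \<alpha> = \<alpha>\<^sub>0 *s lfa_rhs s \<omega>\<^sub>1 \<omega>\<^sub>2"
  shows "operator_symbol s \<omega>\<^sub>1 \<omega>\<^sub>2 * ((cmod \<alpha>\<^sub>0)\<^sup>2 - (cmod (\<alpha> $ 1))\<^sup>2)
    = block_energy s (correction \<omega>\<^sub>1 \<omega>\<^sub>2 \<alpha>\<^sub>0 \<alpha>)"
  using block_solve_energy_change [OF assms(1), of \<omega>\<^sub>1 \<omega>\<^sub>2 \<alpha>\<^sub>0 \<alpha>] assms(2)
  by (simp add: lfa_system_iff_block_solve [symmetric] block_energy_def)
   (simp add: lfa_system_iff_block_solve)

section \<open>The symbol of an elliptic stencil\<close>

definition elliptic :: "stencil \<Rightarrow> bool" where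
  "elliptic s \<longleftrightarrow> centrally_symmetric s \<and> (\<forall>d. d \<noteq> 0 \<longrightarrow> block_energy s d > 0) \<and>
     (\<forall>(\<omega>\<^sub>1, \<omega>\<^sub>2) \<in> high_frequencies. operator_symbol s \<omega>\<^sub>1 \<omega>\<^sub>2 > 0)"

text \<open>
  A kernel vector is an error created out of a vanishing \<open>\<alpha>\<^sub>0\<close>.  The balance makes its
  correction energy nonpositive, so there is no correction and all amplitudes equal \<open>\<alpha>\<^sub>0\<close>.
\<close>

lemma invertible_lfa_matrix:
  assumes "elliptic s" and "(\<omega>\<^sub>1, \<omega>\<^sub>2) \<in> high_frequencies"
  shows "invertible (lfa_matrix s \<omega>\<^sub>1 \<omega>\<^sub>2)"
  unfolding invertible_left_inverse matrix_left_invertible_ker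
proof (intro allI impI)
  fix \<alpha> assume "lfa_matrix s \<omega>\<^sub>1 \<omega>\<^sub>2 *v \<alpha> = 0"
  then have "operator_symbol s \<omega>\<^sub>1 \<omega>\<^sub>2 * (- (cmod (\<alpha> $ 1))\<^sup>2) = block_energy s (correction \<omega>\<^sub>1 \<omega>\<^sub>2 0 \<alpha>)"
    using assms energy_balance [of s \<omega>\<^sub>1 \<omega>\<^sub>2 \<alpha> 0] by (simp add: elliptic_def)
  moreover have "operator_symbol s \<omega>\<^sub>1 \<omega>\<^sub>2 > 0"
    using assms by (auto simp: elliptic_def)
  then have "operator_symbol s \<omega>\<^sub>1 \<omega>\<^sub>2 * (cmod (\<alpha> $ 1))\<^sup>2 \<ge> 0"
    by simp
  ultimately have "\<not> block_energy s (correction \<omega>\<^sub>1 \<omega>\<^sub>2 0 \<alpha>) > 0"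
    by simp
  then have "correction \<omega>\<^sub>1 \<omega>\<^sub>2 0 \<alpha> = 0"
    using assms(1) by (auto simp: elliptic_def)
  then have "\<alpha>$4 = 0" "\<alpha>$3 = \<alpha>$4" "\<alpha>$2 = \<alpha>$3" "\<alpha>$1 = \<alpha>$2"
    using correction_nth [of \<omega>\<^sub>1 \<omega>\<^sub>2 0 \<alpha>] by simp_all
  then show "\<alpha> = 0"
    unfolding vec_eq_iff forall_4 zero_index by metis
qed

text \<open>
  The free factor \<open>\<alpha>\<^sub>0\<close> lets explicit solutions be given without denominators.
\<close>

lemma schwarz_symbol_eq:
  assumes "elliptic s" and "(\<omega>\<^sub>1, \<omega>\<^sub>2) \<in> high_frequencies"
    and "lfa_matrix s \<omega>\<^sub>1 \<omega>\<^sub>2 *v \<alpha> = \<alpha>\<^sub>0 *s lfa_rhs s \<omega>\<^sub>1 \<omega>\<^sub>2"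
  shows "\<alpha> $ 1 = \<alpha>\<^sub>0 * schwarz_symbol s \<omega>\<^sub>1 \<omega>\<^sub>2"
  using matrix_inv_mult_vector [OF invertible_lfa_matrix [OF assms(1,2)] assms(3)]
  by (auto simp: schwarz_symbol_def vec.scale)

lemma cmod_schwarz_symbol_le_1:
  assumes "elliptic s" and "(\<omega>\<^sub>1, \<omega>\<^sub>2) \<in> high_frequencies"
  shows "cmod (schwarz_symbol s \<omega>\<^sub>1 \<omega>\<^sub>2) \<le> 1"
proof -
  obtain B where B: "lfa_matrix s \<omega>\<^sub>1 \<omega>\<^sub>2 ** B = mat 1"
    using invertible_lfa_matrix [OF assms] by (auto simp: invertible_def)
  then have "lfa_matrix s \<omega>\<^sub>1 \<omega>\<^sub>2 *v (B *v lfa_rhs s \<omega>\<^sub>1 \<omega>\<^sub>2) = lfa_rhs s \<omega>\<^sub>1 \<omega>\<^sub>2"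
    by (simp add: matrix_vector_mul_assoc)
  then obtain \<alpha> where \<alpha>: "lfa_matrix s \<omega>\<^sub>1 \<omega>\<^sub>2 *v \<alpha> = 1 *s lfa_rhs s \<omega>\<^sub>1 \<omega>\<^sub>2"
    by auto
  have "block_energy s d \<ge> 0" for d
    using assms(1) by (cases "d = 0") (auto simp: elliptic_def block_energy_def less_imp_le)
  then have "operator_symbol s \<omega>\<^sub>1 \<omega>\<^sub>2 * (1 - (cmod (\<alpha> $ 1))\<^sup>2) \<ge> 0"
    using energy_balance [OF _ \<alpha>] assms(1) by (simp add: elliptic_def)
  moreover have "operator_symbol s \<omega>\<^sub>1 \<omega>\<^sub>2 > 0"
    using assms by (auto simp: elliptic_def)
  ultimately have "(cmod (\<alpha> $ 1))\<^sup>2 \<le> 1"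
    by (simp add: zero_le_mult_iff)
  then show ?thesis
    using schwarz_symbol_eq [OF assms \<alpha>] by (simp add: power_le_one_iff)
qed

text \<open>
  A supremum of reals is meaningful only over a bounded set, so the upper bound on the symbol is
  also what makes a single frequency a lower bound for the smoothing factor.
\<close>

lemma smoothing_factor_bounds:
  assumes "elliptic s" and "(\<omega>\<^sub>1, \<omega>\<^sub>2) \<in> high_frequencies"
  shows "cmod (schwarz_symbol s \<omega>\<^sub>1 \<omega>\<^sub>2) \<le> smoothing_factor s" and "smoothing_factor s \<le> 1"
proof -
  let ?f = "\<lambda>(\<omega>\<^sub>1, \<omega>\<^sub>2). cmod (schwarz_symbol s \<omega>\<^sub>1 \<omega>\<^sub>2)"
  have le: "?f \<omega> \<le> 1" if "\<omega> \<in> high_frequencies" for \<omega>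
    using cmod_schwarz_symbol_le_1 [OF assms(1)] that by (cases \<omega>) auto
  then have "bdd_above (?f ` high_frequencies)"
    by (auto intro!: bdd_aboveI2)
  from cSUP_upper [OF assms(2) this]
  show "cmod (schwarz_symbol s \<omega>\<^sub>1 \<omega>\<^sub>2) \<le> smoothing_factor s"
    by (simp add: smoothing_factor_def)
  show "smoothing_factor s \<le> 1"
    unfolding smoothing_factor_def using assms(2) le by (intro cSUP_least) auto
qed

section \<open>Ellipticity of the two discretizations\<close>

lemma high_frequencies_cos_less_1:
  assumes "(\<omega>\<^sub>1, \<omega>\<^sub>2) \<in> high_frequencies"
  shows "cos \<omega>\<^sub>1 < 1 \<or> cos \<omega>\<^sub>2 < 1"
proof (rule ccontr)
  have zero: "\<omega> = 0" if "\<omega> \<in> {- pi/2 ..< 3 * pi/2}" "\<not> cos \<omega> < 1" for \<omega> :: real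
  proof -
    have "cos \<omega> = 1"
      using that(2) cos_le_one [of \<omega>] by linarith
    then obtain k :: int where k: "\<omega> = k * 2 * pi"
      by (auto simp: cos_one_2pi_int)
    moreover have "- pi < \<omega>" "\<omega> < 2 * pi"
      using that(1) pi_gt_zero unfolding atLeastLessThan_iff by linarith+
    ultimately have "pi * (- 1) < pi * (of_int k * 2)" "pi * (of_int k * 2) < pi * 2"
      by (simp_all add: mult_ac)
    then have "- 1 < of_int k * (2::real)" "of_int k * 2 < (2::real)"
      unfolding mult_less_cancel_left_pos [OF pi_gt_zero] .
    then have "k = 0"
      by linarith
    with k show ?thesis
      by simp
  qed
  assume "\<not> (cos \<omega>\<^sub>1 < 1 \<or> cos \<omega>\<^sub>2 < 1)"
  then have "\<omega>\<^sub>1 = 0" "\<omega>\<^sub>2 = 0"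
    using assms by (auto intro!: zero simp: high_frequencies_def)
  then show False
    using assms by (simp add: high_frequencies_def)
qed

text \<open>
  Both operators have symbols of this form: the one-dimensional second differences in the two
  directions, weighted by constants (finite differences) or by mass matrix symbols (finite
  elements).
\<close>

lemma high_frequencies_weighted_pos:
  assumes "(\<omega>\<^sub>1, \<omega>\<^sub>2) \<in> high_frequencies" and "a > 0" and "b > 0"
  shows "(1 - cos \<omega>\<^sub>1) * a + (1 - cos \<omega>\<^sub>2) * b > 0"
proof -
  have "(1 - cos \<omega>\<^sub>1) * a \<ge> 0" "(1 - cos \<omega>\<^sub>2) * b \<ge> 0"
    using assms(2,3) by simp_all
  moreover have "(1 - cos \<omega>\<^sub>1) * a > 0 \<or> (1 - cos \<omega>\<^sub>2) * b > 0"
    using high_frequencies_cos_less_1 [OF assms(1)] assms(2,3) by (auto simp: zero_less_mult_iff)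
  ultimately show ?thesis
    by linarith
qed

text \<open>
  The block matrix of a stencil with two reflection symmetries is diagonal in the Walsh basis of
  the block, the products of even and odd functions in the two directions.
\<close>

lemma block_energy_walsh:
  "4 * block_energy (symmetric_stencil nw n w c) d =
     (c + w + n + nw) * (cmod (d$1 + d$2 + d$3 + d$4))\<^sup>2
   + (c + w - n - nw) * (cmod (d$1 + d$2 - d$3 - d$4))\<^sup>2
   + (c - w + n - nw) * (cmod (d$1 - d$2 + d$3 - d$4))\<^sup>2
   + (c - w - n + nw) * (cmod (d$1 - d$2 - d$3 + d$4))\<^sup>2"
  unfolding block_energy_def sum_4 block_matrix_nth cmod_power2
  by (simp add: power2_eq_square) algebra

lemma block_energy_pos:
  assumes "c + w + n + nw > 0" "c + w - n - nw > 0" "c - w + n - nw > 0" "c - w - n + nw > 0"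
    and "d \<noteq> 0"
  shows "block_energy (symmetric_stencil nw n w c) d > 0"
proof (rule ccontr)
  let ?u = "d$1 + d$2 + d$3 + d$4" and ?v = "d$1 + d$2 - d$3 - d$4"
    and ?x = "d$1 - d$2 + d$3 - d$4" and ?y = "d$1 - d$2 - d$3 + d$4"
  have nn: "(c + w + n + nw) * (cmod ?u)\<^sup>2 \<ge> 0" "(c + w - n - nw) * (cmod ?v)\<^sup>2 \<ge> 0"
    "(c - w + n - nw) * (cmod ?x)\<^sup>2 \<ge> 0" "(c - w - n + nw) * (cmod ?y)\<^sup>2 \<ge> 0"
    using assms(1-4) by simp_all
  assume "\<not> ?thesis"
  with nn block_energy_walsh [of nw n w c d]
  have "(c + w + n + nw) * (cmod ?u)\<^sup>2 = 0" "(c + w - n - nw) * (cmod ?v)\<^sup>2 = 0"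
    "(c - w + n - nw) * (cmod ?x)\<^sup>2 = 0" "(c - w - n + nw) * (cmod ?y)\<^sup>2 = 0"
    by linarith+
  then have "?u = 0" "?v = 0" "?x = 0" "?y = 0"
    using assms(1-4) by auto
  then have "4 * d$1 = 0" "4 * d$2 = 0" "4 * d$3 = 0" "4 * d$4 = 0"
    by algebra+
  then have "d = 0"
    by (simp add: vec_eq_iff forall_4)
  with assms(5) show False
    by simp
qed

lemma elliptic_fd_stencil:
  assumes "\<epsilon> > 0"
  shows "elliptic (fd_stencil \<epsilon>)"
  unfolding elliptic_def
proof (intro conjI allI impI ballI, goal_cases)
  case 1
  show ?case by (simp add: centrally_symmetric_def fd_stencil_def)
next
  case (2 d)
  then show ?case
    using assms unfolding fd_stencil_def by (intro block_energy_pos) auto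
next
  case (3 \<omega>)
  obtain \<omega>\<^sub>1 \<omega>\<^sub>2 where \<omega>: "\<omega> = (\<omega>\<^sub>1, \<omega>\<^sub>2)"
    by (cases \<omega>)
  have "operator_symbol (fd_stencil \<epsilon>) \<omega>\<^sub>1 \<omega>\<^sub>2 = (1 - cos \<omega>\<^sub>1) * 2 + (1 - cos \<omega>\<^sub>2) * (2 * \<epsilon>)"
    by (simp add: operator_symbol_def fd_stencil_def algebra_simps)
  then have "operator_symbol (fd_stencil \<epsilon>) \<omega>\<^sub>1 \<omega>\<^sub>2 > 0"
    using high_frequencies_weighted_pos [of \<omega>\<^sub>1 \<omega>\<^sub>2 2 "2 * \<epsilon>"] 3 \<omega> assms by simp
  then show ?case
    by (simp add: \<omega>)
qed

lemma elliptic_fe_stencil: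
  assumes "\<epsilon> > 0"
  shows "elliptic (fe_stencil \<epsilon>)"
  unfolding elliptic_def
proof (intro conjI allI impI ballI, goal_cases)
  case 1
  show ?case by (simp add: centrally_symmetric_def fe_stencil_def)
next
  case (2 d)
  then show ?case
    using assms unfolding fe_stencil_def by (intro block_energy_pos) auto
next
  case (3 \<omega>)
  obtain \<omega>\<^sub>1 \<omega>\<^sub>2 where \<omega>: "\<omega> = (\<omega>\<^sub>1, \<omega>\<^sub>2)"
    by (cases \<omega>)
  have "operator_symbol (fe_stencil \<epsilon>) \<omega>\<^sub>1 \<omega>\<^sub>2 =
      (1 - cos \<omega>\<^sub>1) * (2/3 * (2 + cos \<omega>\<^sub>2)) + (1 - cos \<omega>\<^sub>2) * (\<epsilon> * (2/3 * (2 + cos \<omega>\<^sub>1)))"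
    by (simp add: operator_symbol_def fe_stencil_def cos_add cos_diff field_simps)
  moreover have "2 + cos \<omega>\<^sub>1 > 0" "2 + cos \<omega>\<^sub>2 > 0"
    using cos_ge_minus_one [of \<omega>\<^sub>1] cos_ge_minus_one [of \<omega>\<^sub>2] by linarith+
  ultimately have "operator_symbol (fe_stencil \<epsilon>) \<omega>\<^sub>1 \<omega>\<^sub>2 > 0"
    using high_frequencies_weighted_pos [of \<omega>\<^sub>1 \<omega>\<^sub>2 "2/3 * (2 + cos \<omega>\<^sub>2)" "\<epsilon> * (2/3 * (2 + cos \<omega>\<^sub>1))"]
      3 \<omega> assms by simp
  then show ?case
    by (simp add: \<omega>)
qed

section \<open>The symbol at a slowly damped frequency\<close>

lemma zero_pi_half_high_frequency: "(0, pi/2) \<in> high_frequencies"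
  using pi_gt_zero by (simp add: high_frequencies_def)

text \<open>
  At \<open>(0, \<pi>/2)\<close> the phases are \<open>1\<close> and \<open>\<i>\<close>, and the system has entries that are linear in
  \<open>\<epsilon>\<close>.  The vector and the scalar in the proof are, up to a common constant factor, the
  numerators and the denominator of Cramer's rule.
\<close>

lemma cmod_fd_symbol:
  assumes "\<epsilon> > 0"
  shows "cmod (schwarz_symbol (fd_stencil \<epsilon>) 0 (pi/2)) =
    cmod (Complex (1 - 8*\<epsilon>^2 - 12*\<epsilon>^3 - 3*\<epsilon>^4) (6*\<epsilon> + 6*\<epsilon>^2)) /
    cmod (Complex (1 + 12*\<epsilon> + 36*\<epsilon>^2 + 36*\<epsilon>^3 + 9*\<epsilon>^4) (6*\<epsilon> + 24*\<epsilon>^2 + 24*\<epsilon>^3 + 6*\<epsilon>^4))"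
    (is "_ = cmod ?p / cmod ?q")
proof -
  let ?\<alpha> = "vector [?p,
      Complex (1 + 2*\<epsilon> - 8*\<epsilon>^2 - 12*\<epsilon>^3 - 3*\<epsilon>^4) (6*\<epsilon> + 12*\<epsilon>^2 + 8*\<epsilon>^3),
      Complex (1 + 6*\<epsilon> - 4*\<epsilon>^2 - 12*\<epsilon>^3 - 3*\<epsilon>^4) (6*\<epsilon> + 22*\<epsilon>^2 + 24*\<epsilon>^3 + 6*\<epsilon>^4),
      Complex (1 + 8*\<epsilon> + 8*\<epsilon>^2 - 2*\<epsilon>^3 - 3*\<epsilon>^4) (6*\<epsilon> + 22*\<epsilon>^2 + 24*\<epsilon>^3 + 6*\<epsilon>^4)] :: complex^4"
  have "lfa_matrix (fd_stencil \<epsilon>) 0 (pi/2) *v ?\<alpha> = ?q *s lfa_rhs (fd_stencil \<epsilon>) 0 (pi/2)"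
    unfolding lfa_system_iff_block_solve
    by (simp add: vec_eq_iff forall_4 correction_nth residual_nth
        block_matrix_nth modulated_simps fd_stencil_def complex_eq_iff)
       (simp add: algebra_simps power2_eq_square power3_eq_cube power4_eq_xxxx)
  from schwarz_symbol_eq [OF elliptic_fd_stencil [OF assms] zero_pi_half_high_frequency this]
  have "cmod ?p = cmod ?q * cmod (schwarz_symbol (fd_stencil \<epsilon>) 0 (pi/2))"
    by (simp add: norm_mult)
  moreover have "1 + 12*\<epsilon> + 36*\<epsilon>^2 + 36*\<epsilon>^3 + 9*\<epsilon>^4 > 0"
    using assms by (intro add_pos_pos) auto
  then have "?q \<noteq> 0"
    by (simp add: complex_eq_iff)
  ultimately show ?thesis
    by (simp add: field_simps)
qed

lemma cmod_fe_symbol: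
  assumes "\<epsilon> > 0"
  shows "cmod (schwarz_symbol (fe_stencil \<epsilon>) 0 (pi/2)) =
    cmod (Complex (25 - 30*\<epsilon> - 368*\<epsilon>^2 - 714*\<epsilon>^3 - 113*\<epsilon>^4)
      (300*\<epsilon> + 180*\<epsilon>^2 - 108*\<epsilon>^3 + 12*\<epsilon>^4)) /
    cmod (Complex (25 + 450*\<epsilon> + 1648*\<epsilon>^2 + 1878*\<epsilon>^3 + 367*\<epsilon>^4)
      (300*\<epsilon> + 1260*\<epsilon>^2 + 1188*\<epsilon>^3 + 228*\<epsilon>^4))"
    (is "_ = cmod ?p / cmod ?q")
proof -
  let ?\<alpha> = "vector [?p,
      Complex (25 + 50*\<epsilon> - 504*\<epsilon>^2 - 650*\<epsilon>^3 - 121*\<epsilon>^4)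
        (280*\<epsilon> + 544*\<epsilon>^2 + 488*\<epsilon>^3 - 64*\<epsilon>^4),
      Complex (25 + 210*\<epsilon> - 440*\<epsilon>^2 - 714*\<epsilon>^3 - 89*\<epsilon>^4)
        (240*\<epsilon> + 1008*\<epsilon>^2 + 1296*\<epsilon>^3 + 240*\<epsilon>^4),
      Complex (25 + 290*\<epsilon> + 144*\<epsilon>^2 - 362*\<epsilon>^3 - 241*\<epsilon>^4)
        (260*\<epsilon> + 1004*\<epsilon>^2 + 1276*\<epsilon>^3 + 244*\<epsilon>^4)] :: complex^4"
  have "lfa_matrix (fe_stencil \<epsilon>) 0 (pi/2) *v ?\<alpha> = ?q *s lfa_rhs (fe_stencil \<epsilon>) 0 (pi/2)"
    unfolding lfa_system_iff_block_solve
    by (simp add: vec_eq_iff forall_4 correction_nth residual_nth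
        block_matrix_nth modulated_simps fe_stencil_def complex_eq_iff)
       (simp add: algebra_simps power2_eq_square power3_eq_cube power4_eq_xxxx)
  from schwarz_symbol_eq [OF elliptic_fe_stencil [OF assms] zero_pi_half_high_frequency this]
  have "cmod ?p = cmod ?q * cmod (schwarz_symbol (fe_stencil \<epsilon>) 0 (pi/2))"
    by (simp add: norm_mult)
  moreover have "25 + 450*\<epsilon> + 1648*\<epsilon>^2 + 1878*\<epsilon>^3 + 367*\<epsilon>^4 > 0"
    using assms by (intro add_pos_pos) auto
  then have "?q \<noteq> 0"
    by (simp add: complex_eq_iff)
  ultimately show ?thesis
    by (simp add: field_simps)
qed

lemma fd_symbol_expansion:
  "(\<lambda>\<epsilon>. cmod (schwarz_symbol (fd_stencil \<epsilon>) 0 (pi/2)) - 1 + 12 * \<epsilon>) \<in> O[at_right 0](\<lambda>\<epsilon>. \<epsilon>^2)"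
proof -
  have "?thesis \<longleftrightarrow> (\<lambda>\<epsilon>. sqrt ((1 - 8*\<epsilon>^2 - 12*\<epsilon>^3 - 3*\<epsilon>^4)^2 + (6*\<epsilon> + 6*\<epsilon>^2)^2) /
      sqrt ((1 + 12*\<epsilon> + 36*\<epsilon>^2 + 36*\<epsilon>^3 + 9*\<epsilon>^4)^2 + (6*\<epsilon> + 24*\<epsilon>^2 + 24*\<epsilon>^3 + 6*\<epsilon>^4)^2)
      - 1 + 12 * \<epsilon>) \<in> O[at_right (0::real)](\<lambda>\<epsilon>. \<epsilon>^2)"
    by (intro landau_o.big.in_cong eventually_mono [OF eventually_at_right_less])
      (simp add: cmod_fd_symbol complex_norm)
  also have "\<dots>"
    by real_asymp
  finally show ?thesis by simp
qed

lemma fe_symbol_expansion: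
  "(\<lambda>\<epsilon>. cmod (schwarz_symbol (fe_stencil \<epsilon>) 0 (pi/2)) - 1 + 19.2 * \<epsilon>) \<in> O[at_right 0](\<lambda>\<epsilon>. \<epsilon>^2)"
proof -
  have "?thesis \<longleftrightarrow> (\<lambda>\<epsilon>. sqrt ((25 - 30*\<epsilon> - 368*\<epsilon>^2 - 714*\<epsilon>^3 - 113*\<epsilon>^4)^2
        + (300*\<epsilon> + 180*\<epsilon>^2 - 108*\<epsilon>^3 + 12*\<epsilon>^4)^2) /
      sqrt ((25 + 450*\<epsilon> + 1648*\<epsilon>^2 + 1878*\<epsilon>^3 + 367*\<epsilon>^4)^2
        + (300*\<epsilon> + 1260*\<epsilon>^2 + 1188*\<epsilon>^3 + 228*\<epsilon>^4)^2)
      - 1 + 19.2 * \<epsilon>) \<in> O[at_right (0::real)](\<lambda>\<epsilon>. \<epsilon>^2)"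
    by (intro landau_o.big.in_cong eventually_mono [OF eventually_at_right_less])
      (simp add: cmod_fe_symbol complex_norm)
  also have "\<dots>"
    by real_asymp
  finally show ?thesis by simp
qed

section \<open>The smoothing factor for vanishing anisotropy ratio\<close>

lemma tendsto_1_of_expansion:
  fixes g :: "real \<Rightarrow> real"
  assumes "(\<lambda>\<epsilon>. g \<epsilon> - 1 + c * \<epsilon>) \<in> O[at_right 0](\<lambda>\<epsilon>. \<epsilon>^2)"
  shows "(g \<longlongrightarrow> 1) (at_right 0)"
proof -
  have "(\<lambda>\<epsilon>::real. \<epsilon>^2) \<in> o[at_right 0](\<lambda>_. 1 :: real)"
    by real_asymp
  from smalloD_tendsto [OF landau_o.big_small_trans [OF assms this]]
  have "((\<lambda>\<epsilon>. g \<epsilon> - 1 + c * \<epsilon>) \<longlongrightarrow> 0) (at_right 0)"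
    by simp
  then have "((\<lambda>\<epsilon>. (g \<epsilon> - 1 + c * \<epsilon>) + (1 - c * \<epsilon>)) \<longlongrightarrow> 0 + (1 - c * 0)) (at_right 0)"
    by (intro tendsto_intros)
  then show ?thesis
    by simp
qed

lemma smoothing_factor_limit:
  fixes T :: "real \<Rightarrow> stencil"
  assumes ell: "\<And>\<epsilon>. \<epsilon> > 0 \<Longrightarrow> elliptic (T \<epsilon>)" and \<omega>: "(\<omega>\<^sub>1, \<omega>\<^sub>2) \<in> high_frequencies"
    and expansion: "(\<lambda>\<epsilon>. cmod (schwarz_symbol (T \<epsilon>) \<omega>\<^sub>1 \<omega>\<^sub>2) - 1 + c * \<epsilon>) \<in> O[at_right 0](\<lambda>\<epsilon>. \<epsilon>^2)"
  shows "\<exists>R \<in> O[at_right 0](\<lambda>\<epsilon>. \<epsilon>^2). \<forall>\<epsilon>. smoothing_factor (T \<epsilon>) \<ge> 1 - c * \<epsilon> + R \<epsilon>"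
    and "((\<lambda>\<epsilon>. smoothing_factor (T \<epsilon>)) \<longlongrightarrow> 1) (at_right 0)"
proof -
  let ?g = "\<lambda>\<epsilon>. cmod (schwarz_symbol (T \<epsilon>) \<omega>\<^sub>1 \<omega>\<^sub>2)"
  \<comment> \<open>The stencil need not be elliptic for \<open>\<epsilon> \<le> 0\<close>; there the remainder is chosen to give equality,
    which does not affect its order as \<open>\<epsilon>\<close> tends to 0 from above.\<close>
  define R where "R \<epsilon> = (if \<epsilon> > 0 then ?g \<epsilon> else smoothing_factor (T \<epsilon>)) - 1 + c * \<epsilon>" for \<epsilon>
  have "R \<in> O[at_right 0](\<lambda>\<epsilon>. \<epsilon>^2) \<longleftrightarrow> (\<lambda>\<epsilon>. ?g \<epsilon> - 1 + c * \<epsilon>) \<in> O[at_right 0](\<lambda>\<epsilon>. \<epsilon>^2)"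
    by (intro landau_o.big.in_cong eventually_mono [OF eventually_at_right_less])
      (simp add: R_def)
  moreover have "smoothing_factor (T \<epsilon>) \<ge> 1 - c * \<epsilon> + R \<epsilon>" for \<epsilon>
    using smoothing_factor_bounds(1) [OF ell \<omega>] by (simp add: R_def)
  ultimately show "\<exists>R \<in> O[at_right 0](\<lambda>\<epsilon>. \<epsilon>^2). \<forall>\<epsilon>. smoothing_factor (T \<epsilon>) \<ge> 1 - c * \<epsilon> + R \<epsilon>"
    using expansion by blast
  show "((\<lambda>\<epsilon>. smoothing_factor (T \<epsilon>)) \<longlongrightarrow> 1) (at_right 0)"
  proof (rule tendsto_sandwich)
    show "(?g \<longlongrightarrow> 1) (at_right 0)"
      by (rule tendsto_1_of_expansion [OF expansion])
    show "\<forall>\<^sub>F \<epsilon> in at_right 0. ?g \<epsilon> \<le> smoothing_factor (T \<epsilon>)"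
      and "\<forall>\<^sub>F \<epsilon> in at_right 0. smoothing_factor (T \<epsilon>) \<le> 1"
      by (rule eventually_mono [OF eventually_at_right_less];
          rule smoothing_factor_bounds [OF ell \<omega>]; assumption)+
  qed simp
qed

lemma not_epsilon_robust_if_limit_ge_1:
  assumes "(\<mu> \<longlongrightarrow> L) (at_right 0)" and "L \<ge> 1"
  shows "\<not> epsilon_robust \<mu>"
proof
  assume "epsilon_robust \<mu>"
  then obtain \<eta> where \<eta>: "\<eta> < 1" "\<And>\<epsilon>. \<epsilon> \<in> {0..1} \<Longrightarrow> \<mu> \<epsilon> \<le> \<eta>"
    by (auto simp: epsilon_robust_def)
  have "\<forall>\<^sub>F \<epsilon> in at_right 0. \<epsilon> \<in> {0<..<1::real}"
    by (rule eventually_at_rightI) auto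
  then have "\<forall>\<^sub>F \<epsilon> in at_right 0. \<mu> \<epsilon> \<le> \<eta>"
    by (rule eventually_mono) (auto intro: \<eta>(2))
  with assms(1) have "L \<le> \<eta>"
    by (rule tendsto_upperbound) simp
  with \<eta>(1) assms(2) show False
    by simp
qed

theorem lemma1:
  fixes discretization :: "real \<Rightarrow> stencil" and c :: real and \<mu> :: "real \<Rightarrow> real"
  assumes "(discretization = fd_stencil \<and> c = 12) \<or> (discretization = fe_stencil \<and> c = 19.2)"
    and "\<And>\<epsilon>. \<mu> \<epsilon> = smoothing_factor (discretization \<epsilon>)"
  shows "(\<exists>R \<in> O[at_right 0](\<lambda>\<epsilon>. \<epsilon>^2). \<forall>\<epsilon>\<in>{0..1}. \<mu> \<epsilon> \<ge> 1 - c * \<epsilon> + R \<epsilon>)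
    \<and> (\<exists>L. (\<mu> \<longlongrightarrow> L) (at_right 0) \<and> L \<ge> 1)
    \<and> \<not> epsilon_robust \<mu>"
proof -
  have elliptic: "elliptic (discretization \<epsilon>)" if "\<epsilon> > 0" for \<epsilon>
    using assms(1) elliptic_fd_stencil [OF that] elliptic_fe_stencil [OF that] by auto
  have expansion: "(\<lambda>\<epsilon>. cmod (schwarz_symbol (discretization \<epsilon>) 0 (pi/2)) - 1 + c * \<epsilon>)
      \<in> O[at_right 0](\<lambda>\<epsilon>. \<epsilon>^2)"
    using assms(1) by (elim disjE conjE) (simp_all only: fd_symbol_expansion fe_symbol_expansion)
  note limit = smoothing_factor_limit [OF elliptic zero_pi_half_high_frequency expansion]
  have \<mu>: "\<mu> = (\<lambda>\<epsilon>. smoothing_factor (discretization \<epsilon>))"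
    using assms(2) by auto
  have "\<not> epsilon_robust \<mu>"
    by (rule not_epsilon_robust_if_limit_ge_1 [of _ 1]) (simp_all add: \<mu> limit(2))
  with limit show ?thesis
    unfolding \<mu> by (auto intro!: exI [of _ 1])
qed
end
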